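(* Let $K$ be a positive (i.e. $K\ge0$), radially symmetric kernel on $\mathbb{R}^d$ of unit mass, with rapid decay. Let $\phi^0:\mathbb{R}^d\to\mathbb{R}$ be bounded and continuous and let $\phi^n$, $n\ge0$, be generated by the two-step median filter $$\phi^{n+\frac12}=\max\{\phi^n,\ \mathbf{M}_K\phi^n\},\qquad \phi^{n+1}=\min\{\phi^{n+\frac12},\ \mathbf{M}_K\phi^{n+\frac12}\}$$ (pointwise maximum and minimum). Then the algorithm dissipates the energy $$\mathcal{E}_K(\phi)=\iint K(x-y)\,|\phi(x)-\phi(y)|\,dx\,dy\in[0,\infty],$$ i.e. $\mathcal{E}_K(\phi^{n+1})\le\mathcal{E}_K(\phi^n)$ for every $n\ge0$.
   Context: The kernel $K$ is a nonnegative radially symmetric function with $\int K=1$ decaying at infinity faster than any power of $|x|$; one also allows $K$ to be a singular kernel, namely a finite positive combination of surface measures on spheres centered at $0$ with total mass $1$, in which case $\int f(y)K(x-y)\,dy$ means integration of $z\mapsto f(x-z)$ against the measure $K$, and similarly in the double integral. No condition on the Fourier transform of $K$ is assumed. For $\lambda\in\mathbb{R}$ and bounded continuous $\phi$, $\mathbf{T}_\lambda\phi=\{x:\phi(x)\ge\lambda\}$, $\psi_K\phi(x,\lambda)=\int_{\mathbf{T}_\lambda\phi}K(x-y)\,dy$, and the weighted median of $\phi$ at $x$ is $$\mathbf{M}_K\phi(x)=\sup\{\lambda\in\mathbb{R}:\psi_K\phi(x,\lambda)\ge\tfrac12\}.$$ (If $\phi$ is bounded and continuous, so is $\mathbf{M}_K\phi$.)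 *)

theory Defs
  imports "HOL-Analysis.Analysis"
begin

(* A kernel is represented by the measure "K(z) dz": the Lebesgue measure weighted by a function K,
   or a combination of surface measures on spheres. An integral of f(y) K(x - y) dy is the integral
   of z |-> f (x - z) against this measure. *)

definition function_kernel :: "('a::euclidean_space \<Rightarrow> real) \<Rightarrow> bool" where
  "function_kernel K \<longleftrightarrow>
     (\<forall>z. 0 \<le> K z) \<and>
     (\<forall>z w. norm z = norm w \<longrightarrow> K z = K w) \<and>
     integrable lebesgue K \<and> integral\<^sup>L lebesgue K = 1 \<and>
     (\<forall>m::nat. ((\<lambda>z. norm z ^ m * K z) \<longlongrightarrow> 0) at_infinity)"

definition density_kernel :: "('a::euclidean_space \<Rightarrow> real) \<Rightarrow> 'a measure" where
  "density_kernel K = density lebesgue (\<lambda>z. ennreal (K z))"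

(* Surface measure of the sphere of radius r > 0 about 0 in dimension d, defined via polar
   coordinates: the area of A is d / r times the volume of the cone with apex 0 over A. *)

definition sphere_measure :: "real \<Rightarrow> 'a::euclidean_space measure" where
  "sphere_measure r =
     scale_measure (ennreal (DIM('a) / r))
       (distr (restrict_space lborel (ball 0 r - {0})) borel (\<lambda>x. (r / norm x) *\<^sub>R x))"

definition singular_kernel :: "'a::euclidean_space measure \<Rightarrow> bool" where
  "singular_kernel \<kappa> \<longleftrightarrow>
     sets \<kappa> = sets borel \<and>
     (\<exists>R c. finite R \<and> (\<forall>r\<in>R. 0 < r \<and> 0 < c r) \<and>
        (\<forall>A\<in>sets borel. emeasure \<kappa> A = (\<Sum>r\<in>R. ennreal (c r) * emeasure (sphere_measure r) A))) \<and>
     emeasure \<kappa> UNIV = 1"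

definition kernel :: "'a::euclidean_space measure \<Rightarrow> bool" where
  "kernel \<kappa> \<longleftrightarrow> (\<exists>K. function_kernel K \<and> \<kappa> = density_kernel K) \<or> singular_kernel \<kappa>"

definition superlevel :: "('a \<Rightarrow> real) \<Rightarrow> real \<Rightarrow> 'a set" where
  "superlevel \<phi> l = {x. \<phi> x \<ge> l}"

definition psi :: "'a::euclidean_space measure \<Rightarrow> ('a \<Rightarrow> real) \<Rightarrow> 'a \<Rightarrow> real \<Rightarrow> real" where
  "psi \<kappa> \<phi> x l = (\<integral>z. indicator (superlevel \<phi> l) (x - z) \<partial>\<kappa>)"

definition weighted_median :: "'a::euclidean_space measure \<Rightarrow> ('a \<Rightarrow> real) \<Rightarrow> 'a \<Rightarrow> real" where
  "weighted_median \<kappa> \<phi> x = Sup {l. psi \<kappa> \<phi> x l \<ge> 1 / 2}"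

definition energy :: "'a::euclidean_space measure \<Rightarrow> ('a \<Rightarrow> real) \<Rightarrow> ennreal" where
  "energy \<kappa> \<phi> = (\<integral>\<^sup>+x. \<integral>\<^sup>+z. ennreal \<bar>\<phi> x - \<phi> (x - z)\<bar> \<partial>\<kappa> \<partial>lborel)"

(* For a kernel given by a function K, psi and energy are the integrals against K(x - y) dy. *)

lemma reflect_lebesgue:
  fixes x :: "'a::euclidean_space"
  shows "(\<lambda>z. x - z) \<in> lebesgue \<rightarrow>\<^sub>M lebesgue" and "distr lebesgue lebesgue (\<lambda>z. x - z) = lebesgue"
proof -
  have eq: "x + (\<Sum>j\<in>Basis. (- 1 * (z \<bullet> j)) *\<^sub>R j) = x - z" for z :: 'a
    by (simp add: sum_negf euclidean_representation)
  show "(\<lambda>z. x - z) \<in> lebesgue \<rightarrow>\<^sub>M lebesgue"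
    using lebesgue_affine_measurable[of "\<lambda>_. -1" x] unfolding eq by simp
  show "distr lebesgue lebesgue (\<lambda>z. x - z) = lebesgue"
    using lebesgue_affine_euclidean[of "\<lambda>_. -1" x] unfolding eq by (simp add: density_1)
qed

lemma psi_density_kernel:
  fixes K \<phi> :: "'a::euclidean_space \<Rightarrow> real"
  assumes K: "function_kernel K" and [measurable]: "\<phi> \<in> borel_measurable borel"
  shows "psi (density_kernel K) \<phi> x l = (LINT y:superlevel \<phi> l|lebesgue. K (x - y))"
proof -
  have Km[measurable]: "K \<in> borel_measurable lebesgue" and K0: "\<And>z. 0 \<le> K z"
    using K unfolding function_kernel_def by (blast intro: borel_measurable_integrable)+
  have [measurable]: "superlevel \<phi> l \<in> sets borel"
    unfolding superlevel_def by measurable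
  have "superlevel \<phi> l \<in> sets lebesgue" by simp
  then have ind[measurable]: "(indicator (superlevel \<phi> l) :: 'a \<Rightarrow> real) \<in> borel_measurable lebesgue"
    by (rule borel_measurable_indicator)
  have r[measurable]: "(\<lambda>z. x - z) \<in> lebesgue \<rightarrow>\<^sub>M lebesgue"
    by (rule reflect_lebesgue)
  have "psi (density_kernel K) \<phi> x l = (\<integral>z. K z *\<^sub>R indicator (superlevel \<phi> l) (x - z) \<partial>lebesgue)"
    unfolding psi_def density_kernel_def
    by (rule integral_density) (auto simp: K0 intro: measurable_compose[OF r ind])
  also have "\<dots> = (\<integral>z. K z *\<^sub>R indicator (superlevel \<phi> l) (x - z) \<partial>distr lebesgue lebesgue (\<lambda>z. x - z))"
    by (simp only: reflect_lebesgue)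
  also have "\<dots> = (LINT y:superlevel \<phi> l|lebesgue. K (x - y))"
    unfolding set_lebesgue_integral_def
    by (subst integral_distr[OF r])
      (auto intro!: Bochner_Integration.integral_cong borel_measurable_times measurable_compose[OF r ind] Km)
  finally show ?thesis .
qed

lemma energy_density_kernel:
  fixes K \<phi> :: "'a::euclidean_space \<Rightarrow> real"
  assumes K: "function_kernel K" and [measurable]: "\<phi> \<in> borel_measurable borel"
  shows "energy (density_kernel K) \<phi> =
    (\<integral>\<^sup>+x. \<integral>\<^sup>+y. ennreal (K (x - y) * \<bar>\<phi> x - \<phi> y\<bar>) \<partial>lebesgue \<partial>lborel)"
proof -
  have Km[measurable]: "K \<in> borel_measurable lebesgue" and K0: "\<And>z. 0 \<le> K z"
    using K unfolding function_kernel_def by (blast intro: borel_measurable_integrable)+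
  have "(\<integral>\<^sup>+z. ennreal \<bar>\<phi> x - \<phi> (x - z)\<bar> \<partial>density_kernel K) =
      (\<integral>\<^sup>+y. ennreal (K (x - y) * \<bar>\<phi> x - \<phi> y\<bar>) \<partial>lebesgue)" for x
  proof -
    have r: "(\<lambda>z. x - z) \<in> lebesgue \<rightarrow>\<^sub>M lebesgue"
      by (rule reflect_lebesgue)
    have p[measurable]: "(\<lambda>z. ennreal \<bar>\<phi> x - \<phi> (x - z)\<bar>) \<in> borel_measurable lebesgue"
      by (rule measurable_completion) measurable
    have "(\<integral>\<^sup>+z. ennreal \<bar>\<phi> x - \<phi> (x - z)\<bar> \<partial>density_kernel K) =
        (\<integral>\<^sup>+z. ennreal (K z) * ennreal \<bar>\<phi> x - \<phi> (x - z)\<bar> \<partial>lebesgue)"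
      unfolding density_kernel_def by (rule nn_integral_density) measurable
    also have "\<dots> = (\<integral>\<^sup>+z. ennreal (K z) * ennreal \<bar>\<phi> x - \<phi> (x - z)\<bar>
        \<partial>distr lebesgue lebesgue (\<lambda>z. x - z))"
      by (simp only: reflect_lebesgue)
    also have "\<dots> = (\<integral>\<^sup>+y. ennreal (K (x - y)) * ennreal \<bar>\<phi> x - \<phi> y\<bar> \<partial>lebesgue)"
      by (subst nn_integral_distr[OF r]) auto
    finally show ?thesis
      by (simp add: ennreal_mult K0)
  qed
  then show ?thesis
    by (simp add: energy_def)
qed

lemma emeasure_sphere_measure:
  fixes A :: "'a::euclidean_space set"
  assumes "A \<in> sets borel" "0 < r"
  shows "emeasure (sphere_measure r) A =
    ennreal (DIM('a) / r) * emeasure lborel {x \<in> ball 0 r - {0}. (r / norm x) *\<^sub>R x \<in> A}"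
proof -
  have B: "ball 0 r - {0} \<in> sets (lborel :: 'a measure)" by simp
  have m: "(\<lambda>x. (r / norm x) *\<^sub>R x) \<in> restrict_space lborel (ball 0 r - {0}) \<rightarrow>\<^sub>M (borel :: 'a measure)"
    by (rule measurable_restrict_space1) measurable
  have "(\<lambda>x::'a. (r / norm x) *\<^sub>R x) -` A \<inter> space (restrict_space lborel (ball 0 r - {0})) =
      {x \<in> ball 0 r - {0}. (r / norm x) *\<^sub>R x \<in> A}"
    by (auto simp: space_restrict_space)
  then show ?thesis
    unfolding sphere_measure_def using B assms(1)
    by (simp add: emeasure_distr[OF m] emeasure_restrict_space Collect_conj_eq subset_iff)
qed

lemma sphere_measure_sphere:
  assumes "0 < r"
  shows "emeasure (sphere_measure r) (- sphere (0::'a::euclidean_space) r) = 0"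
    and "emeasure (sphere_measure r) (sphere (0::'a) r) =
      ennreal (DIM('a) * unit_ball_vol DIM('a) * r ^ (DIM('a) - 1))"
proof -
  have e1: "{x \<in> ball 0 r - {0::'a}. (r / norm x) *\<^sub>R x \<in> - sphere 0 r} = {}"
    and e2: "{x \<in> ball 0 r - {0::'a}. (r / norm x) *\<^sub>R x \<in> sphere 0 r} = ball 0 r - {0}"
    using assms by auto
  show "emeasure (sphere_measure r) (- sphere (0::'a) r) = 0"
    by (subst emeasure_sphere_measure) (use assms e1 in \<open>auto simp: borel_closed borel_comp\<close>)
  have "emeasure lborel (ball 0 r - {0::'a}) = ennreal (unit_ball_vol DIM('a) * r ^ DIM('a))"
    using assms by (subst emeasure_Diff) (auto simp: emeasure_ball)
  moreover have "r ^ DIM('a) = r * r ^ (DIM('a) - 1)"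
    using DIM_positive[where 'a='a] by (metis power_minus_mult mult.commute)
  ultimately show "emeasure (sphere_measure r) (sphere (0::'a) r) =
      ennreal (DIM('a) * unit_ball_vol DIM('a) * r ^ (DIM('a) - 1))"
    using assms by (simp only: emeasure_sphere_measure e2 borel_closed closed_sphere)
      (simp add: ennreal_mult[symmetric] mult_ac)
qed

end

theory Submission
  imports Defs "HOL-Probability.Probability_Measure"
begin

(* By the coarea formula the energy is the integral over l of the nonlocal perimeters of the
   superlevel sets {\<phi> \<ge> l}. Each half step moves, for every l separately, a set D across the
   boundary of the superlevel set A: into A when at least half of the kernel mass around the points
   of D lies in A, and out of A when less than half does. Hence D interacts at most as much with
   the side it leaves as with the side it joins, and the perimeter does not increase. *)

section \<open>Nonlocal perimeters and the coarea formula\<close>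

text \<open>With y = x - z this is the double integral of K(x - y) over x in \<open>A\<close> and y
  in \<open>B\<close>. For \<open>B = - A\<close> it is the nonlocal perimeter of
  \<open>A\<close>.\<close>

definition interaction :: "'a::euclidean_space measure \<Rightarrow> 'a set \<Rightarrow> 'a set \<Rightarrow> ennreal" where
  "interaction \<kappa> A B = (\<integral>\<^sup>+x. \<integral>\<^sup>+z. indicator A x * indicator B (x - z) \<partial>\<kappa> \<partial>lborel)"

text \<open>Tonelli puts z outermost, translating x by z exchanges the roles of the two points, and
  z is then replaced by -z. Radial symmetry of the kernel enters through this evenness.\<close>

lemma interaction_commute:
  fixes \<kappa> :: "'a::euclidean_space measure"
  assumes "prob_space \<kappa>" and [measurable_cong]: "sets \<kappa> = sets borel"
    and even: "distr \<kappa> borel uminus = \<kappa>"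
    and [measurable]: "A \<in> sets borel" "B \<in> sets borel"
  shows "interaction \<kappa> A B = interaction \<kappa> B A"
proof -
  interpret prob_space \<kappa> by fact
  interpret P: pair_sigma_finite "lborel :: 'a measure" \<kappa> ..
  have "interaction \<kappa> A B = (\<integral>\<^sup>+z. \<integral>\<^sup>+x. indicator A x * indicator B (x - z) \<partial>lborel \<partial>\<kappa>)"
    unfolding interaction_def by (rule P.Fubini'[symmetric]) measurable
  also have "\<dots> = (\<integral>\<^sup>+z. \<integral>\<^sup>+x. indicator A (z + x) * indicator B x \<partial>lborel \<partial>\<kappa>)"
  proof (rule nn_integral_cong)
    fix z
    have "(\<integral>\<^sup>+x. indicator A x * indicator B (x - z) \<partial>lborel) =
        (\<integral>\<^sup>+x. indicator A x * (indicator B (x - z) :: ennreal) \<partial>distr lborel borel ((+) z))"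
      by (simp only: lborel_distr_plus)
    also have "\<dots> = (\<integral>\<^sup>+x. indicator A (z + x) * indicator B x \<partial>lborel)"
      by (subst nn_integral_distr) auto
    finally show "(\<integral>\<^sup>+x. indicator A x * indicator B (x - z) \<partial>lborel) =
        (\<integral>\<^sup>+x. indicator A (z + x) * (indicator B x :: ennreal) \<partial>lborel)" .
  qed
  also have "\<dots> = (\<integral>\<^sup>+x. \<integral>\<^sup>+z. indicator A (z + x) * indicator B x \<partial>\<kappa> \<partial>lborel)"
    by (rule P.Fubini') measurable
  also have "\<dots> = (\<integral>\<^sup>+x. \<integral>\<^sup>+z. indicator A (z + x) * indicator B x \<partial>distr \<kappa> borel uminus \<partial>lborel)"
    by (simp only: even)
  also have "\<dots> = interaction \<kappa> B A"
    unfolding interaction_def by (subst nn_integral_distr) (auto simp: mult.commute)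
  finally show ?thesis .
qed

text \<open>The distance between two reals is the length of the set of levels that separate them.
  Tonelli moves the level outermost. The two summands record which of x and x - z lies above the
  level.\<close>

lemma energy_eq_interaction:
  fixes \<kappa> :: "'a::euclidean_space measure"
  assumes "prob_space \<kappa>" and [measurable_cong]: "sets \<kappa> = sets borel"
    and [measurable]: "\<phi> \<in> borel_measurable borel"
  shows "energy \<kappa> \<phi> =
    (\<integral>\<^sup>+l. interaction \<kappa> (superlevel \<phi> l) (- superlevel \<phi> l) +
           interaction \<kappa> (- superlevel \<phi> l) (superlevel \<phi> l) \<partial>lborel)"
proof -
  interpret prob_space \<kappa> by fact
  interpret P: pair_sigma_finite "lborel :: real measure" \<kappa> ..
  let ?f = "\<lambda>x z l. if l \<le> \<phi> x \<longleftrightarrow> l \<le> \<phi> (x - z) then 0 else 1 :: ennreal"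
  have coarea: "(\<integral>\<^sup>+l. (if l \<le> a \<longleftrightarrow> l \<le> b then 0 else 1) \<partial>lborel) = ennreal \<bar>a - b\<bar>" for a b :: real
  proof -
    \<comment> \<open>Superlevel sets are defined by a non-strict inequality, so the separating
      levels form an interval open on the left and closed on the right.\<close>
    have "(if l \<le> a \<longleftrightarrow> l \<le> b then 0 else 1) = (indicator {min a b<..max a b} l :: ennreal)" for l
      by (cases "l \<le> a"; cases "l \<le> b") (simp_all add: indicator_def max_def)
    then have "(\<integral>\<^sup>+l. (if l \<le> a \<longleftrightarrow> l \<le> b then 0 else 1) \<partial>lborel) = emeasure lborel {min a b<..max a b}"
      by (simp only: nn_integral_indicator sets_lborel greaterThanAtMost_borel)
    also have "\<dots> = ennreal \<bar>a - b\<bar>"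
      by (simp add: abs_real_def max_def min_def)
    finally show ?thesis .
  qed
  have "energy \<kappa> \<phi> = (\<integral>\<^sup>+x. \<integral>\<^sup>+z. \<integral>\<^sup>+l. ?f x z l \<partial>lborel \<partial>\<kappa> \<partial>lborel)"
    by (simp add: energy_def coarea)
  also have "\<dots> = (\<integral>\<^sup>+x. \<integral>\<^sup>+l. \<integral>\<^sup>+z. ?f x z l \<partial>\<kappa> \<partial>lborel \<partial>lborel)"
    by (intro nn_integral_cong P.Fubini') measurable
  also have "\<dots> = (\<integral>\<^sup>+l. \<integral>\<^sup>+x. \<integral>\<^sup>+z. ?f x z l \<partial>\<kappa> \<partial>lborel \<partial>lborel)"
    by (intro lborel_pair.Fubini') measurable
  also have "\<dots> = (\<integral>\<^sup>+l. interaction \<kappa> (superlevel \<phi> l) (- superlevel \<phi> l) +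
           interaction \<kappa> (- superlevel \<phi> l) (superlevel \<phi> l) \<partial>lborel)"
  proof (rule nn_integral_cong)
    fix l
    let ?A = "superlevel \<phi> l"
    have [measurable]: "?A \<in> sets borel" unfolding superlevel_def by measurable
    have "?f x z l = indicator ?A x * indicator (- ?A) (x - z) +
        indicator (- ?A) x * indicator ?A (x - z)" for x z
      by (auto simp: superlevel_def indicator_def)
    then show "(\<integral>\<^sup>+x. \<integral>\<^sup>+z. ?f x z l \<partial>\<kappa> \<partial>lborel) = interaction \<kappa> ?A (- ?A) + interaction \<kappa> (- ?A) ?A"
      by (simp add: interaction_def nn_integral_add)
  qed
  finally show ?thesis .
qed

section \<open>Kernels as even Borel probability measures\<close>

(* A density kernel lives on the Lebesgue sigma-algebra; restricting it to the Borel sets changes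
   neither the energy nor the median of a Borel function. *)
lemma kernel_borel_restriction:
  fixes \<kappa> :: "'a::euclidean_space measure"
  assumes "kernel \<kappa>"
  obtains \<nu> where "prob_space \<nu>" "sets \<nu> = sets borel" "distr \<nu> borel uminus = \<nu>"
    and "\<And>\<phi>. \<phi> \<in> borel_measurable borel \<Longrightarrow> energy \<kappa> \<phi> = energy \<nu> \<phi>"
    and "\<And>\<phi>. \<phi> \<in> borel_measurable borel \<Longrightarrow> weighted_median \<kappa> \<phi> = weighted_median \<nu> \<phi>"
  using assms unfolding kernel_def
proof (elim disjE exE conjE)
  fix K assume K: "function_kernel K" and \<kappa>: "\<kappa> = density_kernel K"
  \<comment> \<open>The push-forward along the identity into \<open>borel\<close> is the restriction
    to the Borel sets.\<close>
  let ?\<nu> = "distr \<kappa> borel (\<lambda>z. z)"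
  have K0: "\<And>z. 0 \<le> K z" and int: "integrable lebesgue K" "integral\<^sup>L lebesgue K = 1"
    using K unfolding function_kernel_def by blast+
  have even: "K (- z) = K z" for z
    using K norm_minus_cancel[of z] unfolding function_kernel_def by blast
  have [measurable]: "K \<in> borel_measurable lebesgue"
    using int(1) by (rule borel_measurable_integrable)
  have id: "(\<lambda>z. z) \<in> \<kappa> \<rightarrow>\<^sub>M borel"
    unfolding \<kappa> density_kernel_def by (simp add: measurable_completion)
  have u: "(uminus :: 'a \<Rightarrow> 'a) \<in> lebesgue \<rightarrow>\<^sub>M lebesgue"
    and du: "distr lebesgue lebesgue (uminus :: 'a \<Rightarrow> 'a) = lebesgue"
    using reflect_lebesgue[of "0::'a"] by simp_all
  have em: "emeasure ?\<nu> A = (\<integral>\<^sup>+z. ennreal (K z) * indicator A z \<partial>lebesgue)"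
    if "A \<in> sets borel" for A
    using that by (simp add: emeasure_distr[OF id]) (simp add: \<kappa> density_kernel_def emeasure_density)
  show thesis
  proof (rule that)
    show "prob_space ?\<nu>"
      using int K0 by (intro prob_spaceI) (simp add: em nn_integral_eq_integral)
    show "distr ?\<nu> borel uminus = ?\<nu>"
    proof (rule measure_eqI)
      fix A assume "A \<in> sets (distr ?\<nu> borel uminus)"
      then have A[measurable]: "A \<in> sets borel" by simp
      then have A': "uminus -` A \<in> sets borel"
        by (rule measurable_sets_borel[rotated]) simp
      have [measurable]: "A \<in> sets lebesgue" by simp
      have "(\<integral>\<^sup>+z. ennreal (K z) * indicator A z \<partial>lebesgue) =
          (\<integral>\<^sup>+z. ennreal (K z) * indicator A z \<partial>distr lebesgue lebesgue uminus)"
        by (simp only: du)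
      also have "\<dots> = (\<integral>\<^sup>+z. ennreal (K z) * indicator (uminus -` A) z \<partial>lebesgue)"
        by (subst nn_integral_distr[OF u]) (auto simp: even indicator_def)
      finally show "emeasure (distr ?\<nu> borel uminus) A = emeasure ?\<nu> A"
        using A A' by (subst emeasure_distr) (auto simp: em)
    qed simp
    fix \<phi> :: "'a \<Rightarrow> real" assume [measurable]: "\<phi> \<in> borel_measurable borel"
    show "energy \<kappa> \<phi> = energy ?\<nu> \<phi>"
      unfolding energy_def by (subst nn_integral_distr[OF id]) auto
    have [measurable]: "superlevel \<phi> l \<in> sets borel" for l
      unfolding superlevel_def by measurable
    have "psi \<kappa> \<phi> x l = psi ?\<nu> \<phi> x l" for x l
      unfolding psi_def by (subst integral_distr[OF id]) auto
    then show "weighted_median \<kappa> \<phi> = weighted_median ?\<nu> \<phi>"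
      by (simp add: weighted_median_def fun_eq_iff)
  qed simp
next
  assume "singular_kernel \<kappa>"
  then obtain R c where s: "sets \<kappa> = sets borel" and one: "emeasure \<kappa> UNIV = 1"
    and R: "\<And>r. r \<in> R \<Longrightarrow> 0 < r"
    and em: "\<And>A. A \<in> sets borel \<Longrightarrow> emeasure \<kappa> A = (\<Sum>r\<in>R. ennreal (c r) * emeasure (sphere_measure r) A)"
    unfolding singular_kernel_def by blast
  have sp: "space \<kappa> = UNIV"
    using sets_eq_imp_space_eq[OF s] by simp
  have reflect: "distr lborel borel uminus = (lborel :: 'a measure)"
    using lborel_affine[of "- 1" "0 :: 'a"] by (simp add: density_1)
  \<comment> \<open>A singular kernel is already a Borel measure and serves as its own restriction.
    Its evenness comes from each sphere separately: the cone over the reflection of \<open>A\<close>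
    is the reflection of the cone over \<open>A\<close>, and Lebesgue measure is invariant under
    reflection.\<close>
  have sphere: "emeasure (sphere_measure r) (uminus -` A) = emeasure (sphere_measure r) A"
    if A[measurable]: "A \<in> sets borel" and "0 < r" for A :: "'a set" and r
  proof -
    have A': "uminus -` A \<in> sets borel"
      by (rule measurable_sets_borel[OF _ A]) simp
    let ?E = "{x \<in> ball 0 r - {0}. (r / norm x) *\<^sub>R x \<in> A}"
    have E: "?E \<in> sets lborel" by measurable
    have "emeasure lborel ?E = emeasure (distr lborel borel uminus) ?E"
      by (simp only: reflect)
    also have "\<dots> = emeasure lborel (uminus -` ?E \<inter> space lborel)"
      using E by (intro emeasure_distr) auto
    also have "uminus -` ?E \<inter> space lborel = {x \<in> ball 0 r - {0}. (r / norm x) *\<^sub>R x \<in> uminus -` A}"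
      by auto
    finally show ?thesis
      using A A' \<open>0 < r\<close> by (simp only: emeasure_sphere_measure)
  qed
  show thesis
  proof (rule that)
    show "prob_space \<kappa>"
      by (rule prob_spaceI) (simp add: sp one)
    show "distr \<kappa> borel uminus = \<kappa>"
    proof (rule measure_eqI)
      fix A assume "A \<in> sets (distr \<kappa> borel uminus)"
      then have A: "A \<in> sets borel" by simp
      then have A': "uminus -` A \<in> sets borel"
        by (rule measurable_sets_borel[rotated]) simp
      have "emeasure (distr \<kappa> borel uminus) A = emeasure \<kappa> (uminus -` A)"
        using A s by (subst emeasure_distr) (auto simp: sp cong: measurable_cong_sets)
      then show "emeasure (distr \<kappa> borel uminus) A = emeasure \<kappa> A"
        by (simp add: em A A' sphere R)
    qed (simp add: s)
  qed (simp_all add: s)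
qed

section \<open>Superlevel sets of the weighted median\<close>

text \<open>The supremum defining the median is attained, because the mass of a superlevel set is
  left-continuous in the level. Consequently the superlevel set of the median at level l depends
  only on the superlevel set of \<open>\<phi>\<close> at the same level, so the filter can be
  analysed one level at a time.\<close>

lemma le_weighted_median_iff:
  fixes \<kappa> :: "'a::euclidean_space measure"
  assumes "prob_space \<kappa>" and [measurable_cong]: "sets \<kappa> = sets borel"
    and [measurable]: "\<phi> \<in> borel_measurable borel" and C: "\<And>x. \<bar>\<phi> x\<bar> \<le> C"
  shows "l \<le> weighted_median \<kappa> \<phi> x \<longleftrightarrow> 1 / 2 \<le> measure \<kappa> {z. l \<le> \<phi> (x - z)}"
proof
  interpret prob_space \<kappa> by fact
  have sp: "space \<kappa> = UNIV"
    using sets_eq_imp_space_eq[OF assms(2)] by simp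
  have psi: "psi \<kappa> \<phi> x l = prob {z. l \<le> \<phi> (x - z)}" for l
  proof -
    have "psi \<kappa> \<phi> x l = (\<integral>z. indicator {z. l \<le> \<phi> (x - z)} z \<partial>\<kappa>)"
      by (simp add: psi_def superlevel_def indicator_def)
    then show ?thesis by (simp add: sp)
  qed
  let ?S = "{l. 1 / 2 \<le> prob {z. l \<le> \<phi> (x - z)}}"
  have M: "weighted_median \<kappa> \<phi> x = Sup ?S"
    by (simp add: weighted_median_def psi)
  have "- C \<le> \<phi> y" for y
    using C[of y] by linarith
  \<comment> \<open>At level \<open>- C\<close> the superlevel set is the whole space, and above
    \<open>C\<close> it is empty. So the supremum is taken over a nonempty set that is bounded
    above.\<close>
  then have ne: "- C \<in> ?S"
    using prob_space by (simp add: sp)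
  have bdd: "bdd_above ?S"
  proof (rule bdd_aboveI, rule ccontr)
    fix m assume m: "m \<in> ?S" and "\<not> m \<le> C"
    then have "\<not> m \<le> \<phi> y" for y
      using C[of y] by linarith
    then show False using m by simp
  qed
  show "1 / 2 \<le> prob {z. l \<le> \<phi> (x - z)} \<Longrightarrow> l \<le> weighted_median \<kappa> \<phi> x"
    unfolding M by (rule cSup_upper[OF _ bdd]) simp
  assume l: "l \<le> weighted_median \<kappa> \<phi> x"
  \<comment> \<open>These levels increase strictly to l, so each lies below the supremum and is
    exceeded by some element of \<open>?S\<close>. The sets decrease to the superlevel set at l, and
    continuity from above carries the bound 1/2 to the limit.\<close>
  let ?A = "\<lambda>n. {z. l - 1 / real (Suc n) \<le> \<phi> (x - z)}"
  have "1 / 2 \<le> prob (?A n)" for n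
  proof -
    have "0 < 1 / real (Suc n)" by simp
    then have "l - 1 / real (Suc n) < Sup ?S"
      using l unfolding M by linarith
    then obtain m where "m \<in> ?S" "l - 1 / real (Suc n) < m"
      using less_cSup_iff[OF _ bdd] ne by blast
    moreover from this have "prob {z. m \<le> \<phi> (x - z)} \<le> prob (?A n)"
      by (intro finite_measure_mono) auto
    ultimately show ?thesis by simp
  qed
  moreover have "(\<lambda>n. prob (?A n)) \<longlonglongrightarrow> prob {z. l \<le> \<phi> (x - z)}"
  proof -
    have "?A n \<subseteq> ?A m" if "m \<le> n" for m n
    proof (rule Collect_mono, rule impI)
      fix z assume "l - 1 / real (Suc n) \<le> \<phi> (x - z)"
      moreover have "1 / real (Suc n) \<le> 1 / real (Suc m)"
        using that by (simp add: frac_le)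
      ultimately show "l - 1 / real (Suc m) \<le> \<phi> (x - z)" by linarith
    qed
    then have "(\<lambda>n. prob (?A n)) \<longlonglongrightarrow> prob (\<Inter>n. ?A n)"
      by (intro finite_Lim_measure_decseq) (auto simp: decseq_def)
    also have "(\<Inter>n. ?A n) = {z. l \<le> \<phi> (x - z)}"
    proof safe
      fix z assume *: "z \<in> (\<Inter>n. ?A n)"
      have "(\<lambda>n. l - 1 / real (Suc n)) \<longlonglongrightarrow> l - 0"
        by (intro tendsto_diff tendsto_const LIMSEQ_Suc lim_1_over_n)
      then show "l \<le> \<phi> (x - z)"
        unfolding diff_0_right by (rule LIMSEQ_le_const2) (use * in blast)
    next
      fix z n assume "l \<le> \<phi> (x - z)"
      moreover have "0 \<le> 1 / real (Suc n)" by simp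
      ultimately show "l - 1 / real (Suc n) \<le> \<phi> (x - z)" by linarith
    qed
    finally show ?thesis .
  qed
  ultimately show "1 / 2 \<le> prob {z. l \<le> \<phi> (x - z)}"
    by (intro LIMSEQ_le_const) auto
qed

section \<open>Energy dissipation along the iteration\<close>

theorem proposition3:
  fixes \<kappa> :: "(real ^ 'd) measure"
    and \<phi> \<phi>half :: "nat \<Rightarrow> real ^ 'd \<Rightarrow> real"
  assumes "kernel \<kappa>"
    and "continuous_on UNIV (\<phi> 0)" and "bounded (range (\<phi> 0))"
    and "\<And>n x. \<phi>half n x = max (\<phi> n x) (weighted_median \<kappa> (\<phi> n) x)"
    and "\<And>n x. \<phi> (Suc n) x = min (\<phi>half n x) (weighted_median \<kappa> (\<phi>half n) x)"
  shows "\<forall>n. energy \<kappa> (\<phi> (Suc n)) \<le> energy \<kappa> (\<phi> n)"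
proof -
  obtain \<nu> where \<nu>: "prob_space \<nu>" "sets \<nu> = sets borel" "distr \<nu> borel uminus = \<nu>"
    and e: "\<And>\<phi>. \<phi> \<in> borel_measurable borel \<Longrightarrow> energy \<kappa> \<phi> = energy \<nu> \<phi>"
    and m: "\<And>\<phi>. \<phi> \<in> borel_measurable borel \<Longrightarrow> weighted_median \<kappa> \<phi> = weighted_median \<nu> \<phi>"
    by (rule kernel_borel_restriction[OF assms(1)]) blast
  interpret prob_space \<nu> by fact
  note commute = interaction_commute[OF \<nu>] and coarea = energy_eq_interaction[OF \<nu>(1,2)]
  note [measurable_cong] = \<nu>(2)
  have sp: "space \<nu> = UNIV"
    using sets_eq_imp_space_eq[OF \<nu>(2)] by simp
  \<comment> \<open>Let D = B - A. Both perimeters contain the interaction of A with - B; what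
    remains is D against - B for the perimeter of B, and A against D for that of A. Since - B is
    disjoint from A, a point of D sees mass at most 1 - 1/2 in - B and at least 1/2 in A. Symmetry
    of the interaction finishes the comparison. The common term may be infinite, so it is added on
    both sides and never subtracted.\<close>
  have grow: "interaction \<nu> B (- B) \<le> interaction \<nu> A (- A)"
    if [measurable]: "A \<in> sets borel" "B \<in> sets borel" and "A \<subseteq> B"
      and half: "\<And>x. x \<in> B - A \<Longrightarrow> 1 / 2 \<le> prob {z. x - z \<in> A}" for A B
  proof -
    let ?D = "B - A"
    have [measurable]: "?D \<in> sets borel" "- B \<in> sets borel" "- A \<in> sets borel"
      by (simp_all add: borel_comp)
    have "interaction \<nu> ?D (- B) \<le> interaction \<nu> ?D A"
      unfolding interaction_def
    proof (rule nn_integral_mono)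
      fix x
      have P: "(\<integral>\<^sup>+z. indicator S (x - z) \<partial>\<nu>) = ennreal (prob {z. x - z \<in> S})"
        if [measurable]: "S \<in> sets borel" for S
      proof -
        have "(\<integral>\<^sup>+z. indicator S (x - z) \<partial>\<nu>) = (\<integral>\<^sup>+z. indicator {z. x - z \<in> S} z \<partial>\<nu>)"
          by (simp add: indicator_def)
        then show ?thesis by (simp add: emeasure_eq_measure)
      qed
      have "prob {z. x - z \<in> - B} \<le> prob {z. x - z \<in> A}" if "x \<in> ?D"
      proof -
        have ev: "{z. x - z \<in> A} \<in> events" by simp
        have "{z. x - z \<in> - B} \<subseteq> space \<nu> - {z. x - z \<in> A}"
          using \<open>A \<subseteq> B\<close> sp by blast
        then have "prob {z. x - z \<in> - B} \<le> prob (space \<nu> - {z. x - z \<in> A})"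
          by (rule finite_measure_mono) (rule sets.compl_sets[OF ev])
        moreover note prob_compl[OF ev]
        ultimately show ?thesis
          using half[OF that] by linarith
      qed
      then show "(\<integral>\<^sup>+z. indicator ?D x * indicator (- B) (x - z) \<partial>\<nu>) \<le>
          (\<integral>\<^sup>+z. indicator ?D x * indicator A (x - z) \<partial>\<nu>)"
        by (cases "x \<in> ?D") (simp_all add: P)
    qed
    moreover have "interaction \<nu> B (- B) = interaction \<nu> A (- B) + interaction \<nu> ?D (- B)"
    proof -
      have "(indicator B x :: ennreal) = indicator A x + indicator ?D x" for x
        using \<open>A \<subseteq> B\<close> by (auto simp: indicator_def)
      then show ?thesis
        unfolding interaction_def by (simp add: distrib_right nn_integral_add)
    qed
    moreover have "interaction \<nu> A (- A) = interaction \<nu> A (- B) + interaction \<nu> A ?D"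
    proof -
      have "(indicator (- A) y :: ennreal) = indicator (- B) y + indicator ?D y" for y
        using \<open>A \<subseteq> B\<close> by (auto simp: indicator_def)
      then show ?thesis
        unfolding interaction_def by (simp add: distrib_left nn_integral_add)
    qed
    ultimately show ?thesis
      using commute[of A ?D] by (simp add: add_left_mono)
  qed
  \<comment> \<open>The coarea formula reduces the claim to one level. The first alternative in
    \<open>step\<close> is meant for the maximum, which enlarges superlevel sets, and the second for
    the minimum, which shrinks them.\<close>
  have energy_le: "energy \<nu> \<psi> \<le> energy \<nu> \<phi>"
    if meas[measurable]: "\<phi> \<in> borel_measurable borel" "\<psi> \<in> borel_measurable borel"
      and step: "\<And>l. superlevel \<phi> l \<subseteq> superlevel \<psi> l \<and>
            (\<forall>x\<in>superlevel \<psi> l - superlevel \<phi> l. 1 / 2 \<le> prob {z. x - z \<in> superlevel \<phi> l}) \<or>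
          superlevel \<psi> l \<subseteq> superlevel \<phi> l \<and>
            (\<forall>x\<in>superlevel \<phi> l - superlevel \<psi> l. prob {z. x - z \<in> superlevel \<phi> l} \<le> 1 / 2)"
    for \<phi> \<psi>
    unfolding coarea[OF meas(1)] coarea[OF meas(2)]
  proof (rule nn_integral_mono)
    fix l
    let ?A = "superlevel \<phi> l" and ?B = "superlevel \<psi> l"
    have A[measurable]: "?A \<in> sets borel" and B[measurable]: "?B \<in> sets borel"
      unfolding superlevel_def by measurable
    have "interaction \<nu> ?B (- ?B) \<le> interaction \<nu> ?A (- ?A)"
      using step[of l]
    proof (elim disjE conjE)
      assume "?A \<subseteq> ?B" "\<forall>x\<in>?B - ?A. 1 / 2 \<le> prob {z. x - z \<in> ?A}"
      then show ?thesis
        by (intro grow[OF A B]) auto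
    next
      assume sub: "?B \<subseteq> ?A" and half: "\<forall>x\<in>?A - ?B. prob {z. x - z \<in> ?A} \<le> 1 / 2"
      \<comment> \<open>Shrinking \<open>?A\<close> to \<open>?B\<close> is growth of the
        complement, and at most half of the mass in \<open>?A\<close> means at least half in
        \<open>- ?A\<close>. A set and its complement have the same perimeter.\<close>
      have "interaction \<nu> (- ?B) (- (- ?B)) \<le> interaction \<nu> (- ?A) (- (- ?A))"
      proof (rule grow[OF borel_comp[OF A] borel_comp[OF B]])
        show "- ?A \<subseteq> - ?B" using sub by blast
        fix x assume "x \<in> - ?B - (- ?A)"
        then have "prob {z. x - z \<in> ?A} \<le> 1 / 2" using half by blast
        moreover have "prob (space \<nu> - {z. x - z \<in> ?A}) = 1 - prob {z. x - z \<in> ?A}"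
          by (rule prob_compl) measurable
        moreover have "{z. x - z \<in> - ?A} = space \<nu> - {z. x - z \<in> ?A}"
          using sp by auto
        ultimately show "1 / 2 \<le> prob {z. x - z \<in> - ?A}" by simp
      qed
      then show ?thesis
        using commute[OF A borel_comp[OF A]] commute[OF B borel_comp[OF B]]
        by simp
    qed
    then show "interaction \<nu> ?B (- ?B) + interaction \<nu> (- ?B) ?B \<le>
        interaction \<nu> ?A (- ?A) + interaction \<nu> (- ?A) ?A"
      using commute[OF A borel_comp[OF A]] commute[OF B borel_comp[OF B]]
      by (simp add: add_mono)
  qed
  obtain C where C: "\<And>x. \<bar>\<phi> 0 x\<bar> \<le> C"
    using assms(3) by (auto simp: bounded_iff)
  \<comment> \<open>This invariant is carried along the iteration with the fixed bound
    \<open>C\<close> of the initial function. It makes the level-set description of the median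
    available at every half step.\<close>
  define adm where "adm f \<longleftrightarrow> f \<in> borel_measurable borel \<and> (\<forall>x. \<bar>f x\<bar> \<le> C)" for f :: "real ^ 'd \<Rightarrow> real"
  have le_median: "l \<le> weighted_median \<kappa> f x \<longleftrightarrow> 1 / 2 \<le> prob {z. l \<le> f (x - z)}" if "adm f" for f l x
    using that le_weighted_median_iff[OF \<nu>(1,2), of f C l x] by (simp add: adm_def m)
  have median: "adm (weighted_median \<kappa> f)" if "adm f" for f
  proof -
    have [measurable]: "f \<in> borel_measurable borel" and B: "\<bar>f x\<bar> \<le> C" for x
      using that by (auto simp: adm_def)
    \<comment> \<open>As an integral over z of a jointly Borel integrand, the mass is a Borel
      function of x. The superlevel sets of the median are then Borel as well.\<close>
    have "prob {z. l \<le> f (x - z)} = (\<integral>z. (if l \<le> f (x - z) then 1 else 0) \<partial>\<nu>)" for l x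
    proof -
      have "(\<integral>z. (if l \<le> f (x - z) then 1 else 0) \<partial>\<nu>) =
          (\<integral>z. indicator {z. l \<le> f (x - z)} z \<partial>\<nu> :: real)"
        by (simp only: indicator_def mem_Collect_eq of_bool_def)
      then show ?thesis by (simp add: sp)
    qed
    then have [measurable]: "(\<lambda>x. prob {z. l \<le> f (x - z)}) \<in> borel_measurable borel" for l
      by simp
    have "weighted_median \<kappa> f \<in> borel_measurable borel"
      unfolding borel_measurable_iff_ge le_median[OF that] by (intro allI) measurable
    moreover have "- C \<le> f y" for y
      using B[of y] by linarith
    then have "- C \<le> weighted_median \<kappa> f x" for x
      unfolding le_median[OF that] using prob_space by (simp add: sp)
    moreover have "weighted_median \<kappa> f x \<le> C" for x
    \<comment> \<open>Taking the median itself as the level, a value above \<open>C\<close> would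
      give mass at least 1/2 to an empty set.\<close>
    proof (rule ccontr)
      assume *: "\<not> weighted_median \<kappa> f x \<le> C"
      have "\<not> weighted_median \<kappa> f x \<le> f y" for y
        using B[of y] * by linarith
      then show False
        using le_median[OF that, of "weighted_median \<kappa> f x" x] by simp
    qed
    ultimately show ?thesis
      unfolding adm_def abs_le_iff by (simp add: minus_le_iff)
  qed
  have max_step: "adm (\<lambda>x. max (f x) (weighted_median \<kappa> f x)) \<and>
      energy \<kappa> (\<lambda>x. max (f x) (weighted_median \<kappa> f x)) \<le> energy \<kappa> f" if f: "adm f" for f
  proof -
    let ?g = "\<lambda>x. max (f x) (weighted_median \<kappa> f x)"
    have fm: "f \<in> borel_measurable borel"
      using f by (simp add: adm_def)
    have g: "adm ?g"
      using f median[OF f] by (auto simp: adm_def abs_le_iff max_def)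
    then have gm: "?g \<in> borel_measurable borel"
      by (simp add: adm_def)
    have "energy \<nu> ?g \<le> energy \<nu> f"
      \<comment> \<open>A point that joins the superlevel set does so because the median there is at
        least l, that is, because at least half of the mass around it lies in the old set.\<close>
      by (rule energy_le[OF fm gm]) (auto simp: superlevel_def le_max_iff_disj le_median[OF f])
    then show ?thesis
      using g by (simp only: e[OF fm] e[OF gm] simp_thms)
  qed
  have min_step: "adm (\<lambda>x. min (f x) (weighted_median \<kappa> f x)) \<and>
      energy \<kappa> (\<lambda>x. min (f x) (weighted_median \<kappa> f x)) \<le> energy \<kappa> f" if f: "adm f" for f
  proof -
    let ?g = "\<lambda>x. min (f x) (weighted_median \<kappa> f x)"
    have fm: "f \<in> borel_measurable borel"
      using f by (simp add: adm_def)
    have g: "adm ?g"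
      using f median[OF f] by (auto simp: adm_def abs_le_iff min_def)
    then have gm: "?g \<in> borel_measurable borel"
      by (simp add: adm_def)
    have "energy \<nu> ?g \<le> energy \<nu> f"
      \<comment> \<open>A point leaves the superlevel set only if the median there is below l, so
        less than half of the mass around it lies in the old set.\<close>
      by (rule energy_le[OF fm gm]) (auto simp: superlevel_def le_median[OF f])
    then show ?thesis
      using g by (simp only: e[OF fm] e[OF gm] simp_thms)
  qed
  have half: "\<phi>half n = (\<lambda>x. max (\<phi> n x) (weighted_median \<kappa> (\<phi> n) x))" for n
    by (simp add: fun_eq_iff assms(4))
  have full: "\<phi> (Suc n) = (\<lambda>x. min (\<phi>half n x) (weighted_median \<kappa> (\<phi>half n) x))" for n
    by (simp add: fun_eq_iff assms(5))
  have "adm (\<phi> n)" for n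
  proof (induction n)
    case 0
    show ?case
      using C assms(2) by (simp add: adm_def borel_measurable_continuous_onI)
  next
    case (Suc n)
    then show ?case
      unfolding full half by (intro min_step[THEN conjunct1] max_step[THEN conjunct1])
  qed
  \<comment> \<open>The maximum step bounds the energy of the half iterate by that of
    \<open>\<phi> n\<close>, and the minimum step, applied to the half iterate, gives the second
    inequality of the chain.\<close>
  then show ?thesis
    unfolding full half using max_step min_step by (blast intro: order_trans)
qed

end
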